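(* Let $T$ be the rooted plane tree of depth $1$ with $N\ge2$ leaves. The velocity fan $\mathcal F(T)$ of the categorical $1$-associahedron $\mathcal K(T)$ is the wonderful associahedral fan $\mathcal F_N$, i.e. the normal fan of Loday's polytopal realization of the associahedron.
   Context: **Velocity fan for depth 1.** Let $T$ have a root and ordered leaves $1,\dots,N$. A categorical $1$-associahedron $\mathcal K(T)$ is the poset, ordered by inclusion, of sets $\mathcal B$ of brackets (nonempty intervals of consecutive elements of $[N]$) containing $[N]$ and all singletons, and such that any two intersecting members are comparable by inclusion (disjoint brackets are ordered left to right). Its minimum is $\mathcal B_{\min}=\{[N],\{1\},\dots,\{N\}\}$. Collisions are the atoms: $\mathcal C=\mathcal B_{\min}\cup\{A\}$ with $A$ an interval, $2\le|A|\le N-1$. The contraction $T/\mathcal C$ is the depth-$1$ tree obtained by merging the leaves in $A$ to a single leaf, with induced order, and $\psi$ is the induced map on leaves. The general definition of the ray generator is $\rho(\mathcal C)_i=d(\psi(i))-d(\psi(i+1))+1$, $1\le i\le N-1$, where $d(v)$ is the position of the leaf $v$ in the order of leaves of $T/\mathcal C$. For $\mathcal B\in\mathcal K(T)$, $\tau(\mathcal B)=\mathrm{cone}\{\rho(\mathcal C):\mathcal C\le\mathcal B\text{ a collision}\}+\mathbb R\mathbf 1\subset\mathbb R^{N-1}$, $\mathbf 1$ the all-ones vector, and $\mathcal F(T)=\{\tau(\mathcal B):\mathcal B\in\mathcal K(T)\}$. **Wonderful associahedral fan.** For a bracket (interval) $A\subseteq[N]$ let $\rho(A)\in\mathbb R^{N-1}$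 have $i$-th entry $1$ if $i,i+1\in A$ and $0$ otherwise. For a bracketing $\mathcal B$ of $[N]$ (a set of nonempty intervals of consecutive elements of $[N]$ that contains $[N]$ and all singletons $\{1\},\dots,\{N\}$, and such that any two intersecting members are comparable by inclusion), put $\tau'(\mathcal B)=\mathrm{cone}\{\rho(A):A\in\mathcal B\}+\mathbb R\mathbf 1$. $\mathcal F_N=\{\tau'(\mathcal B)\}$ over all bracketings. It is known to be the (inner) normal fan of Loday's realization of the associahedron, $\{x\in\mathbb R^{N-1}:\sum_ix_i=\binom N2,\ \sum_{i=a}^{b-1}x_i\ge\binom{b-a+1}2\ \text{for }1\le a<b\le N\}$. *)

theory Defs
  imports "HOL-Analysis.Analysis"
begin

text \<open>
  The rooted plane tree \<open>T\<close> of depth \<open>1\<close> with ordered leaves \<open>1, \<dots>, N\<close> is represented by the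
  number \<open>N\<close>. Vectors in \<open>\<real>\<^sup>N\<^sup>-\<^sup>1\<close> are elements of \<open>real ^ 'n\<close> together with a bijection
  \<open>pos\<close> from the index type \<open>'n\<close> onto \<open>{1..N-1}\<close>: the component \<open>x $ k\<close> is the entry of \<open>x\<close>
  with number \<open>pos k\<close>.
\<close>

subsection \<open>Bracketings and the categorical 1-associahedron\<close>

definition brackets :: "nat \<Rightarrow> nat set set" where
  "brackets N = {{a..b} | a b. 1 \<le> a \<and> a \<le> b \<and> b \<le> N}"

definition min_bracketing :: "nat \<Rightarrow> nat set set" where
  "min_bracketing N = insert {1..N} {{j} | j. j \<in> {1..N}}"

definition bracketing :: "nat \<Rightarrow> nat set set \<Rightarrow> bool" where
  "bracketing N B \<longleftrightarrow>
     B \<subseteq> brackets N \<and> min_bracketing N \<subseteq> B \<and>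
     (\<forall>A\<in>B. \<forall>A'\<in>B. A \<inter> A' \<noteq> {} \<longrightarrow> A \<subseteq> A' \<or> A' \<subseteq> A)"

text \<open>The underlying set of the poset \<open>\<K>(T)\<close>; its order is inclusion.\<close>

definition categorical_associahedron :: "nat \<Rightarrow> nat set set set" where
  "categorical_associahedron N = {B. bracketing N B}"

definition collision :: "nat \<Rightarrow> nat set set \<Rightarrow> bool" where
  "collision N C \<longleftrightarrow>
     (\<exists>A\<in>brackets N. 2 \<le> card A \<and> card A \<le> N - 1 \<and> C = insert A (min_bracketing N))"

subsection \<open>Contraction by a collision and the velocity fan\<close>

definition merged_bracket :: "nat \<Rightarrow> nat set set \<Rightarrow> nat set" where
  "merged_bracket N C = (THE A. A \<in> C \<and> A \<notin> min_bracketing N)"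

text \<open>
  The leaves of \<open>T/C\<close> are encoded as the sets of leaves of \<open>T\<close> that are identified with each
  other, so that the induced map \<open>\<psi>\<close> on leaves sends a leaf to its class.
\<close>

definition contraction_map :: "nat \<Rightarrow> nat set set \<Rightarrow> nat \<Rightarrow> nat set" where
  "contraction_map N C j = (if j \<in> merged_bracket N C then merged_bracket N C else {j})"

definition contraction_leaves :: "nat \<Rightarrow> nat set set \<Rightarrow> nat set set" where
  "contraction_leaves N C = contraction_map N C ` {1..N}"

definition leaf_le :: "nat set \<Rightarrow> nat set \<Rightarrow> bool" where
  "leaf_le u v \<longleftrightarrow> u = v \<or> (\<forall>x\<in>u. \<forall>y\<in>v. x < y)"

definition leaf_position :: "nat \<Rightarrow> nat set set \<Rightarrow> nat set \<Rightarrow> nat" where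
  "leaf_position N C v = card {u \<in> contraction_leaves N C. leaf_le u v}"

definition ray_generator :: "nat \<Rightarrow> ('n::finite \<Rightarrow> nat) \<Rightarrow> nat set set \<Rightarrow> real ^ 'n" where
  "ray_generator N pos C =
     (\<chi> k. real (leaf_position N C (contraction_map N C (pos k)))
         - real (leaf_position N C (contraction_map N C (pos k + 1))) + 1)"

text \<open>
  The set \<open>cone S + \<real>\<one>\<close>, where \<open>cone\<close> denotes the set of all nonnegative linear combinations
  (so \<open>cone {} = {0}\<close>), and \<open>1 :: real ^ 'n\<close> is the all-ones vector.
\<close>

definition cone_mod_ones :: "(real ^ 'n::finite) set \<Rightarrow> (real ^ 'n) set" where
  "cone_mod_ones S = {x + t *\<^sub>R 1 | x t. x \<in> convex_cone hull S}"

definition velocity_cone ::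
    "nat \<Rightarrow> ('n::finite \<Rightarrow> nat) \<Rightarrow> nat set set \<Rightarrow> (real ^ 'n) set" where
  "velocity_cone N pos B = cone_mod_ones {ray_generator N pos C | C. collision N C \<and> C \<subseteq> B}"

definition velocity_fan :: "nat \<Rightarrow> ('n::finite \<Rightarrow> nat) \<Rightarrow> (real ^ 'n) set set" where
  "velocity_fan N pos = velocity_cone N pos ` categorical_associahedron N"

subsection \<open>The wonderful associahedral fan\<close>

definition bracket_vector :: "('n::finite \<Rightarrow> nat) \<Rightarrow> nat set \<Rightarrow> real ^ 'n" where
  "bracket_vector pos A = (\<chi> k. if pos k \<in> A \<and> pos k + 1 \<in> A then 1 else 0)"

definition wonderful_cone :: "('n::finite \<Rightarrow> nat) \<Rightarrow> nat set set \<Rightarrow> (real ^ 'n) set" where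
  "wonderful_cone pos B = cone_mod_ones (bracket_vector pos ` B)"

definition wonderful_associahedral_fan ::
    "nat \<Rightarrow> ('n::finite \<Rightarrow> nat) \<Rightarrow> (real ^ 'n) set set" where
  "wonderful_associahedral_fan N pos = {wonderful_cone pos B | B. bracketing N B}"

subsection \<open>Inner normal fans and Loday's associahedron\<close>

definition inner_normal_cone :: "'a::euclidean_space set \<Rightarrow> 'a set \<Rightarrow> 'a set" where
  "inner_normal_cone P F = {y. \<forall>x\<in>F. \<forall>z\<in>P. y \<bullet> x \<le> y \<bullet> z}"

definition inner_normal_fan :: "'a::euclidean_space set \<Rightarrow> 'a set set" where
  "inner_normal_fan P = {inner_normal_cone P F | F. F face_of P \<and> F \<noteq> {}}"

definition loday_associahedron :: "nat \<Rightarrow> ('n::finite \<Rightarrow> nat) \<Rightarrow> (real ^ 'n) set" where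
  "loday_associahedron N pos =
     {x. (\<Sum>k\<in>UNIV. x $ k) = real (N choose 2) \<and>
         (\<forall>a b. 1 \<le> a \<and> a < b \<and> b \<le> N \<longrightarrow>
            (\<Sum>k | pos k \<in> {a..b-1}. x $ k) \<ge> real ((b - a + 1) choose 2))}"

end

theory Submission
  imports Defs
begin

text \<open>
  For a collision merging the bracket \<open>A\<close>, consecutive leaves have equal position after the
  contraction if both lie in \<open>A\<close>, and positions differing by one otherwise; so \<open>\<rho>\<close> of the collision is
  \<open>\<rho>(A)\<close>, and the remaining brackets only contribute \<open>0\<close> and the all-ones vector.

  For the normal fan, view \<open>y \<in> \<real>\<^sup>N\<^sup>-\<^sup>1\<close> as a height function on the gaps between consecutive leaves. The
  intervals that are strictly higher than both adjacent gaps form a bracketing, and lowering the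
  highest plateaus one at a time writes \<open>y\<close> as a nonnegative combination of their vectors
  \<open>\<rho>(A)\<close>, modulo the all-ones vector. Conversely, let every pair of leaves distribute a unit mass over
  the lowest gaps between them: the resulting point of Loday's polytope is tight exactly at these
  intervals, because a bracket with \<open>n\<close> leaves always receives the mass of its \<open>n choose 2\<close> inner pairs.
  Hence this point minimises \<open>y\<close>, and the cone of normals of a face is spanned by the brackets tight
  on it. Supermodularity of \<open>n choose 2\<close> makes these brackets nested, and the height function
  counting the brackets of a given bracketing around each gap realises that bracketing.
\<close>

subsection \<open>Cones modulo the all-ones vector\<close>

lemma convex_cone_cone_mod_ones: "convex_cone (cone_mod_ones S)"
  unfolding convex_cone_iff
proof (intro conjI ballI allI impI)
  show "0 \<in> cone_mod_ones S"
    unfolding cone_mod_ones_def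
    by (rule CollectI, rule exI[of _ 0], rule exI[of _ 0]) (simp add: convex_cone_hull_contains_0)
next
  fix x y assume "x \<in> cone_mod_ones S" "y \<in> cone_mod_ones S"
  then obtain u s v t where "u \<in> convex_cone hull S" "v \<in> convex_cone hull S"
      "x = u + s *\<^sub>R 1" "y = v + t *\<^sub>R 1"
    unfolding cone_mod_ones_def by blast
  moreover from this have "x + y = (u + v) + (s + t) *\<^sub>R 1"
    by (simp add: scaleR_left_distrib)
  ultimately show "x + y \<in> cone_mod_ones S"
    unfolding cone_mod_ones_def by (blast intro: convex_cone_hull_add)
next
  fix x and c :: real assume "x \<in> cone_mod_ones S" "0 \<le> c"
  then obtain u s where "u \<in> convex_cone hull S" "x = u + s *\<^sub>R 1"
    unfolding cone_mod_ones_def by blast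
  moreover from this have "c *\<^sub>R x = c *\<^sub>R u + (c * s) *\<^sub>R 1"
    by (simp add: scaleR_right_distrib)
  ultimately show "c *\<^sub>R x \<in> cone_mod_ones S"
    unfolding cone_mod_ones_def using \<open>0 \<le> c\<close> by (blast intro: convex_cone_hull_mul)
qed

lemma subset_cone_mod_ones: "S \<subseteq> cone_mod_ones S"
proof
  fix x assume "x \<in> S"
  then have "x \<in> convex_cone hull S" "x = x + 0 *\<^sub>R 1"
    by (simp_all add: hull_inc)
  then show "x \<in> cone_mod_ones S"
    unfolding cone_mod_ones_def by blast
qed

lemma ones_in_cone_mod_ones: "t *\<^sub>R 1 \<in> cone_mod_ones S"
proof -
  have "t *\<^sub>R 1 = 0 + t *\<^sub>R (1 :: real ^ 'n)" by simp
  then show ?thesis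
    unfolding cone_mod_ones_def using convex_cone_hull_contains_0 by blast
qed

lemma cone_mod_ones_minimal:
  assumes "convex_cone K" "S \<subseteq> K" "\<And>t. t *\<^sub>R 1 \<in> K"
  shows "cone_mod_ones S \<subseteq> K"
proof
  fix x assume "x \<in> cone_mod_ones S"
  then obtain u t where "u \<in> convex_cone hull S" "x = u + t *\<^sub>R 1"
    unfolding cone_mod_ones_def by blast
  moreover have "convex_cone hull S \<subseteq> K"
    using assms by (intro hull_minimal)
  ultimately show "x \<in> K"
    using assms(3) convex_cone_add[OF assms(1)] by blast
qed

lemma cone_mod_ones_mono: "S \<subseteq> T \<Longrightarrow> cone_mod_ones S \<subseteq> cone_mod_ones T"
  using subset_cone_mod_ones
  by (intro cone_mod_ones_minimal convex_cone_cone_mod_ones ones_in_cone_mod_ones) blast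

lemma sum_in_convex_cone:
  assumes "convex_cone K" "\<And>i. i \<in> I \<Longrightarrow> f i \<in> K"
  shows "sum f I \<in> K"
  using assms(2)
  by (induction I rule: infinite_finite_induct)
    (auto intro: convex_cone_add convex_cone_contains_0 assms(1))

text \<open>The combinations on the right form a convex cone containing all generators and all
  multiples of the all-ones vector, so minimality applies. Coefficients belong to indices rather
  than vectors because \<open>f\<close> may fail to be injective: all singleton brackets have vector
  0.\<close>

lemma cone_mod_ones_image_coeffs:
  assumes "finite I" "y \<in> cone_mod_ones (f ` I)"
  obtains c t where "\<And>i. 0 \<le> c i" "y = (\<Sum>i\<in>I. c i *\<^sub>R f i) + t *\<^sub>R 1"
proof -
  let ?K = "{y. \<exists>c t. (\<forall>i. 0 \<le> c i) \<and> y = (\<Sum>i\<in>I. c i *\<^sub>R f i) + t *\<^sub>R 1}"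
  have "cone_mod_ones (f ` I) \<subseteq> ?K"
  proof (rule cone_mod_ones_minimal)
    show "convex_cone ?K"
      unfolding convex_cone_iff
    proof (intro conjI ballI allI impI)
      show "0 \<in> ?K"
        by (rule CollectI, rule exI[of _ "\<lambda>_. 0"], rule exI[of _ 0]) simp
    next
      fix x y assume "x \<in> ?K" "y \<in> ?K"
      then obtain c s d t where "\<forall>i. 0 \<le> c i" "\<forall>i. 0 \<le> d i"
        "x = (\<Sum>i\<in>I. c i *\<^sub>R f i) + s *\<^sub>R 1" "y = (\<Sum>i\<in>I. d i *\<^sub>R f i) + t *\<^sub>R 1"
        by blast
      then show "x + y \<in> ?K"
        by (intro CollectI exI[of _ "\<lambda>i. c i + d i"] exI[of _ "s + t"])
          (simp add: scaleR_left_distrib sum.distrib)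
    next
      fix x and e :: real assume "x \<in> ?K" "0 \<le> e"
      then obtain c s where "\<forall>i. 0 \<le> c i" "x = (\<Sum>i\<in>I. c i *\<^sub>R f i) + s *\<^sub>R 1"
        by blast
      then show "e *\<^sub>R x \<in> ?K" using \<open>0 \<le> e\<close>
        by (intro CollectI exI[of _ "\<lambda>i. e * c i"] exI[of _ "e * s"])
          (simp add: scaleR_right_distrib scaleR_sum_right)
    qed
    show "f ` I \<subseteq> ?K"
    proof safe
      fix i assume "i \<in> I"
      then have "(\<Sum>j\<in>I. (if j = i then 1 else 0) *\<^sub>R f j) = f i"
        using assms(1) by (simp add: if_distrib[of "\<lambda>c. c *\<^sub>R _"] cong: if_cong)
      then show "\<exists>c t. (\<forall>i. 0 \<le> c i) \<and> f i = (\<Sum>i\<in>I. c i *\<^sub>R f i) + t *\<^sub>R 1"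
        by (intro exI[of _ "\<lambda>j. if j = i then 1 else 0"] exI[of _ 0]) simp
    qed
    show "t *\<^sub>R 1 \<in> ?K" for t
      by (rule CollectI, rule exI[of _ "\<lambda>_. 0"], rule exI[of _ t]) simp
  qed
  then have "y \<in> ?K" using assms(2) by (rule subsetD)
  then obtain c t where "\<forall>i. 0 \<le> c i" "y = (\<Sum>i\<in>I. c i *\<^sub>R f i) + t *\<^sub>R 1"
    by blast
  then show thesis by (intro that) simp_all
qed

subsection \<open>Brackets and collisions\<close>

lemma bracketsE:
  assumes "A \<in> brackets N"
  obtains a b where "A = {a..b}" "1 \<le> a" "a \<le> b" "b \<le> N"
  using assms unfolding brackets_def by blast

lemma bracketsI: "1 \<le> a \<Longrightarrow> a \<le> b \<Longrightarrow> b \<le> N \<Longrightarrow> {a..b} \<in> brackets N"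
  unfolding brackets_def by blast

lemma brackets_subset: "A \<in> brackets N \<Longrightarrow> A \<subseteq> {1..N}"
  by (auto elim: bracketsE)

lemma finite_brackets: "finite (brackets N)"
  by (rule finite_subset[of _ "Pow {1..N}"]) (auto elim: bracketsE)

lemma bracketing_subset: "bracketing N B \<Longrightarrow> B \<subseteq> brackets N"
  by (simp add: bracketing_def)

lemma bracketing_finite: "bracketing N B \<Longrightarrow> finite B"
  using bracketing_subset finite_brackets finite_subset by blast

lemma bracketing_nested:
  "\<lbrakk>bracketing N B; A \<in> B; A' \<in> B; A \<inter> A' \<noteq> {}\<rbrakk> \<Longrightarrow> A \<subseteq> A' \<or> A' \<subseteq> A"
  by (simp add: bracketing_def)

lemma whole_in_bracketing: "bracketing N B \<Longrightarrow> {1..N} \<in> B"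
  by (auto simp: bracketing_def min_bracketing_def)

text \<open>Two intersecting intervals that are not nested must cross, and up to symmetry the one
  that starts first also ends first. Only this one shape has to be excluded.\<close>

lemma bracketingI:
  assumes "B \<subseteq> brackets N" "{1..N} \<in> B" "\<And>j. j \<in> {1..N} \<Longrightarrow> {j} \<in> B"
    and "\<And>a b c d. \<lbrakk>{a..b} \<in> B; {c..d} \<in> B; 1 \<le> a; a < c; c \<le> b; b < d; d \<le> N\<rbrakk> \<Longrightarrow> False"
  shows "bracketing N B"
  unfolding bracketing_def
proof (intro conjI ballI impI)
  show "min_bracketing N \<subseteq> B"
    using assms(2,3) by (auto simp: min_bracketing_def)
  fix A A' assume A: "A \<in> B" "A' \<in> B" "A \<inter> A' \<noteq> {}"
  obtain a b where ab: "A = {a..b}" "1 \<le> a" "a \<le> b" "b \<le> N"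
    using A assms(1) by (blast elim: bracketsE)
  obtain c d where cd: "A' = {c..d}" "1 \<le> c" "c \<le> d" "d \<le> N"
    using A assms(1) by (blast elim: bracketsE)
  have "c \<le> b" "a \<le> d" using A(3) ab cd by auto
  moreover have "\<not> (a < c \<and> b < d)" "\<not> (c < a \<and> d < b)"
    using assms(4)[of a b c d] assms(4)[of c d a b] A(1,2) ab cd \<open>c \<le> b\<close> \<open>a \<le> d\<close> by blast+
  ultimately show "A \<subseteq> A' \<or> A' \<subseteq> A"
    unfolding ab(1) cd(1) by auto
qed (use assms(1) in auto)

text \<open>Classes keep the order of their leaves. A leaf beyond \<open>i\<close> can only
  contribute when it is merged with \<open>i\<close>, and then its class is already counted.\<close>

lemma leaf_position_contraction:
  fixes N a b :: nat
  defines "C \<equiv> insert {a..b} (min_bracketing N)"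
  assumes m: "merged_bracket N C = {a..b}" and ab: "1 \<le> a" "a \<le> b" "b \<le> N" and i: "i \<in> {1..N}"
  shows "leaf_position N C (contraction_map N C i) = card (contraction_map N C ` {1..i})"
proof -
  have psi: "contraction_map N C j = (if j \<in> {a..b} then {a..b} else {j})" for j
    by (simp add: contraction_map_def m)
  have le: "leaf_le (contraction_map N C j) (contraction_map N C i) \<longleftrightarrow>
      j \<le> i \<or> contraction_map N C j = contraction_map N C i" for j
    unfolding leaf_le_def psi using ab by (auto split: if_splits)
  have "{u \<in> contraction_leaves N C. leaf_le u (contraction_map N C i)} = contraction_map N C ` {1..i}"
  proof (intro equalityI subsetI)
    fix u assume "u \<in> {u \<in> contraction_leaves N C. leaf_le u (contraction_map N C i)}"
    then obtain j where "j \<in> {1..N}" "u = contraction_map N C j"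
        "j \<le> i \<or> contraction_map N C j = contraction_map N C i"
      unfolding contraction_leaves_def using le by blast
    then consider "j \<in> {1..i}" "u = contraction_map N C j" | "u = contraction_map N C i"
      by auto
    then show "u \<in> contraction_map N C ` {1..i}"
      using i by cases simp_all
  next
    fix u assume "u \<in> contraction_map N C ` {1..i}"
    then obtain j where "j \<in> {1..N}" "j \<le> i" "u = contraction_map N C j"
      using i by force
    then show "u \<in> {u \<in> contraction_leaves N C. leaf_le u (contraction_map N C i)}"
      unfolding contraction_leaves_def using le[of j] by blast
  qed
  then show ?thesis by (simp add: leaf_position_def)
qed

lemma ray_generator_collision:
  fixes pos :: "'n::finite \<Rightarrow> nat"
  assumes pos: "bij_betw pos UNIV {1..N-1}"
    and A: "A \<in> brackets N" "2 \<le> card A" "card A \<le> N - 1"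
  shows "ray_generator N pos (insert A (min_bracketing N)) = bracket_vector pos A"
proof -
  obtain a b where ab: "A = {a..b}" "1 \<le> a" "a \<le> b" "b \<le> N"
    using A(1) by (rule bracketsE)
  define C where "C = insert A (min_bracketing N)"
  \<comment> \<open>The two cardinality bounds rule out singletons and the whole set, so
    \<open>A\<close> is the unique bracket that \<open>merged_bracket\<close> selects.\<close>
  have "A \<notin> min_bracketing N"
    using A(2,3) by (auto simp: min_bracketing_def)
  then have m: "merged_bracket N C = A"
    unfolding merged_bracket_def C_def by (intro the_equality) auto
  have psi: "contraction_map N C j = (if j \<in> A then A else {j})" for j
    by (simp add: contraction_map_def m)
  have "ray_generator N pos C $ k = bracket_vector pos A $ k" for k
  proof -
    define i where "i = pos k"
    have i: "i \<in> {1..N}" "i + 1 \<in> {1..N}"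
      using bij_betwE[OF pos, rule_format, of k] unfolding i_def by auto
    have lp: "leaf_position N C (contraction_map N C j) = card (contraction_map N C ` {1..j})"
      if "j \<in> {1..N}" for j
      using leaf_position_contraction[of N a b j] m that ab unfolding C_def by simp
    have "{1..i+1} = insert (i+1) {1..i}" by auto
    then have im: "contraction_map N C ` {1..i+1} =
        insert (contraction_map N C (i+1)) (contraction_map N C ` {1..i})"
      by simp
    \<comment> \<open>The class of leaf \<open>i + 1\<close> is old only if \<open>A\<close>
      contains it and some earlier leaf; as \<open>A\<close> is an interval, it then contains
      \<open>i\<close>.\<close>
    have iff: "contraction_map N C (i+1) \<in> contraction_map N C ` {1..i} \<longleftrightarrow> i \<in> A \<and> i + 1 \<in> A"
    proof
      assume "contraction_map N C (i+1) \<in> contraction_map N C ` {1..i}"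
      then obtain j where "j \<in> {1..i}" "contraction_map N C (i+1) = contraction_map N C j"
        by blast
      moreover have "j \<in> contraction_map N C j" by (simp add: psi)
      ultimately have "j \<le> i" "j \<in> contraction_map N C (i+1)" by simp_all
      then have "j \<le> i" "i + 1 \<in> A" "j \<in> A" by (auto simp: psi split: if_splits)
      then show "i \<in> A \<and> i + 1 \<in> A" by (simp add: ab(1))
    next
      assume "i \<in> A \<and> i + 1 \<in> A"
      then show "contraction_map N C (i+1) \<in> contraction_map N C ` {1..i}"
        using i by (intro image_eqI[of _ _ i]) (auto simp: psi)
    qed
    have "real (card (contraction_map N C ` {1..i+1})) =
        real (card (contraction_map N C ` {1..i})) + (if i \<in> A \<and> i + 1 \<in> A then 0 else 1)"
      unfolding im using iff by (simp add: card_insert_if)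
    then show ?thesis
      using lp i by (simp add: ray_generator_def bracket_vector_def flip: i_def)
  qed
  then show ?thesis by (simp add: vec_eq_iff C_def)
qed

lemma bracket_vector_whole:
  assumes "bij_betw pos UNIV {1..N-1}"
  shows "bracket_vector pos {1..N} = 1"
proof -
  have "pos k \<in> {1..N} \<and> pos k + 1 \<in> {1..N}" for k
    using bij_betwE[OF assms, rule_format, of k] by auto
  then show ?thesis by (simp add: bracket_vector_def vec_eq_iff)
qed

lemma bracket_vector_singleton: "bracket_vector pos {j} = 0"
  by (simp add: bracket_vector_def vec_eq_iff)

lemma velocity_cone_eq_wonderful_cone:
  fixes pos :: "'n::finite \<Rightarrow> nat"
  assumes pos: "bij_betw pos UNIV {1..N-1}" and B: "bracketing N B"
  shows "velocity_cone N pos B = wonderful_cone pos B"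
proof -
  let ?V = "{ray_generator N pos C | C. collision N C \<and> C \<subseteq> B}"
  have min: "min_bracketing N \<subseteq> B" using B by (simp add: bracketing_def)
  have V: "?V = bracket_vector pos ` {A \<in> B. 2 \<le> card A \<and> card A \<le> N - 1}" (is "_ = _ ` ?B'")
  proof (intro equalityI subsetI)
    fix v assume "v \<in> ?V"
    then show "v \<in> bracket_vector pos ` ?B'"
      using ray_generator_collision[OF pos] unfolding collision_def by auto
  next
    fix v assume "v \<in> bracket_vector pos ` ?B'"
    then obtain A where "A \<in> ?B'" "v = bracket_vector pos A" by blast
    then show "v \<in> ?V"
      using ray_generator_collision[OF pos, of A] bracketing_subset[OF B] min
      unfolding collision_def by (intro CollectI exI[of _ "insert A (min_bracketing N)"]) auto
  qed
  have "bracket_vector pos ` B \<subseteq> cone_mod_ones ?V"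
  proof (rule image_subsetI)
    fix A assume "A \<in> B"
    then obtain a b where ab: "A = {a..b}" "1 \<le> a" "a \<le> b" "b \<le> N"
      using bracketing_subset[OF B] by (blast elim: bracketsE)
    consider "a = b" | "a = 1 \<and> b = N" | "a < b" "\<not> (a = 1 \<and> b = N)" using ab by linarith
    then show "bracket_vector pos A \<in> cone_mod_ones ?V"
    proof cases
      case 1
      then show ?thesis
        using ones_in_cone_mod_ones[of 0] by (simp add: ab(1) bracket_vector_singleton)
    next
      case 2
      then show ?thesis
        using ones_in_cone_mod_ones[of 1] bracket_vector_whole[OF pos] by (simp add: ab(1))
    next
      case 3
      then have "A \<in> ?B'" using ab \<open>A \<in> B\<close> by auto
      then have "bracket_vector pos A \<in> ?V" unfolding V by (rule imageI)
      then show ?thesis by (rule subsetD[OF subset_cone_mod_ones])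
    qed
  qed
  then have "cone_mod_ones (bracket_vector pos ` B) \<subseteq> cone_mod_ones ?V"
    by (intro cone_mod_ones_minimal convex_cone_cone_mod_ones ones_in_cone_mod_ones)
  moreover have "cone_mod_ones ?V \<subseteq> cone_mod_ones (bracket_vector pos ` B)"
    unfolding V by (intro cone_mod_ones_mono) blast
  ultimately show ?thesis
    unfolding velocity_cone_def wonderful_cone_def by blast
qed

subsection \<open>Islands of a height function\<close>

text \<open>Gap \<open>i\<close> lies between the leaves \<open>i\<close> and \<open>i + 1\<close>, so \<open>h\<close> matters on \<open>{1..<N}\<close> only and the gaps
  inside \<open>{a..b}\<close> are \<open>{a..<b}\<close>.\<close>

definition islands :: "nat \<Rightarrow> (nat \<Rightarrow> real) \<Rightarrow> nat set set" where
  "islands N h = {{a..b} | a b. 1 \<le> a \<and> a \<le> b \<and> b \<le> N \<and>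
     (\<forall>j\<in>{a..<b}. (1 < a \<longrightarrow> h (a - 1) < h j) \<and> (b < N \<longrightarrow> h b < h j))}"

lemma islands_subset_brackets: "islands N h \<subseteq> brackets N"
  unfolding islands_def brackets_def by blast

lemma finite_islands: "finite (islands N h)"
  using islands_subset_brackets finite_brackets by (rule finite_subset)

lemma Icc_in_islands_iff:
  assumes "1 \<le> a" "a \<le> b" "b \<le> N"
  shows "{a..b} \<in> islands N h \<longleftrightarrow>
    (\<forall>j\<in>{a..<b}. (1 < a \<longrightarrow> h (a - 1) < h j) \<and> (b < N \<longrightarrow> h b < h j))"
  unfolding islands_def using assms by (auto simp: Icc_eq_Icc)

lemma Icc_in_islandsD:
  assumes "{a..b} \<in> islands N h" "a \<le> j" "j < b"
  shows "1 < a \<Longrightarrow> h (a - 1) < h j" "b < N \<Longrightarrow> h b < h j"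
proof -
  have "{a..b} \<in> brackets N" using assms(1) islands_subset_brackets by blast
  then have "1 \<le> a" "a \<le> b" "b \<le> N" using assms(2,3) by (auto simp: brackets_def Icc_eq_Icc)
  then show "1 < a \<Longrightarrow> h (a - 1) < h j" "b < N \<Longrightarrow> h b < h j"
    using assms Icc_in_islands_iff[of a b N h] by auto
qed

text \<open>If two islands crossed, the gap right of the first would lie inside the second and the
  gap left of the second inside the first, so each would be strictly lower than the other.\<close>

lemma bracketing_islands:
  assumes "1 \<le> N" shows "bracketing N (islands N h)"
proof (rule bracketingI)
  show "{1..N} \<in> islands N h" using assms by (subst Icc_in_islands_iff) auto
  show "{j} \<in> islands N h" if "j \<in> {1..N}" for j
    using that Icc_in_islands_iff[of j j N h] by auto
  fix a b c d assume *: "{a..b} \<in> islands N h" "{c..d} \<in> islands N h"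
    and "1 \<le> a" "a < c" "c \<le> b" "b < d" "d \<le> N"
  moreover from this have "a \<le> c - 1" "c - 1 < b" by linarith+
  ultimately have "h b < h (c - 1)" "h (c - 1) < h b"
    using Icc_in_islandsD(2)[OF *(1), of "c - 1"] Icc_in_islandsD(1)[OF *(2), of b] by auto
  then show False by simp
qed (rule islands_subset_brackets)

text \<open>Flattening a highest plateau down to its higher neighbour destroys an island and creates none.\<close>

lemma islands_flatten:
  assumes ab: "1 \<le> a" "a < b" "b \<le> N" and M: "\<And>i. i \<in> {a..<b} \<Longrightarrow> h i = M" and "m < M"
    and l: "1 < a \<Longrightarrow> h (a - 1) \<le> m" and r: "b < N \<Longrightarrow> h b \<le> m"
    and m: "1 < a \<and> h (a - 1) = m \<or> b < N \<and> h b = m"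
  defines "h' \<equiv> \<lambda>i. if i \<in> {a..<b} then m else h i"
  shows "islands N h' \<subset> islands N h" "{a..b} \<in> islands N h"
proof -
  show A: "{a..b} \<in> islands N h"
    using ab l r M \<open>m < M\<close> by (subst Icc_in_islands_iff) force+
  \<comment> \<open>Gap \<open>a\<close> now ties with an adjacent gap of height \<open>m\<close>,
    so strictness fails.\<close>
  have "{a..b} \<notin> islands N h'"
    using ab m by (subst Icc_in_islands_iff) (auto simp: h'_def intro!: bexI[of _ a])
  moreover have "islands N h' \<subseteq> islands N h"
  proof
    fix D assume D: "D \<in> islands N h'"
    then obtain c d where cd: "D = {c..d}" "1 \<le> c" "c \<le> d" "d \<le> N"
      using islands_subset_brackets by (blast elim: bracketsE)
    have le: "h' i \<le> h i" for i using M \<open>m < M\<close> by (auto simp: h'_def)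
    note isl = Icc_in_islandsD[OF D[unfolded cd(1)]]
    have "h (c - 1) < h i" if i: "i \<in> {c..<d}" and "1 < c" for i
    \<comment> \<open>If gap \<open>c - 1\<close> lies in the plateau, then gap \<open>c\<close>
      lies there too or is gap \<open>b\<close>; its new height is at most \<open>m\<close>, which
      contradicts that \<open>D\<close> is an island of \<open>h'\<close>. Otherwise the boundary
      height is the same for \<open>h\<close> and \<open>h'\<close>, and inner heights are no
      smaller for \<open>h\<close>. The right end is the mirror image.\<close>
    proof (cases "c - 1 \<in> {a..<b}")
      case True
      have "h' (c - 1) < h' c" using isl(1)[of c] that by auto
      moreover have "c < N" using i cd by auto
      ultimately show ?thesis
        using True r le[of c] by (cases "c = b") (auto simp: h'_def split: if_splits)
    next
      case False
      then have "h (c - 1) = h' (c - 1)" by (simp only: h'_def if_False)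
      then show ?thesis using isl(1)[of i] le[of i] that by auto
    qed
    moreover have "h d < h i" if i: "i \<in> {c..<d}" and "d < N" for i
    proof (cases "d \<in> {a..<b}")
      case True
      have *: "h' d < h' (d - 1)" using isl(2)[of "d - 1"] that by auto
      show ?thesis
      proof (cases "d = a")
        case d: True
        moreover have "1 < a" "a - 1 \<notin> {a..<b}" using d i cd ab by auto
        ultimately have "h' d < h (a - 1)" "h' d = m" using * d ab by (simp_all add: h'_def)
        then show ?thesis using l \<open>1 < a\<close> by simp
      next
        case False
        then have "d - 1 \<in> {a..<b}" using True by auto
        then show ?thesis using * True by (simp add: h'_def)
      qed
    next
      case False
      then have "h d = h' d" by (simp only: h'_def if_False)
      then show ?thesis using isl(2)[of i] le[of i] that by auto
    qed
    ultimately show "D \<in> islands N h" using cd by (simp add: Icc_in_islands_iff)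
  qed
  ultimately show "islands N h' \<subset> islands N h" using A by blast
qed

text \<open>A run of gaps of maximal height is extended as far as possible to both sides of one
  maximising gap; the next gap on either side then misses the maximum and is strictly lower.\<close>

lemma highest_plateau:
  fixes h :: "nat \<Rightarrow> real"
  assumes "2 \<le> N"
  obtains a b M where "1 \<le> a" "a < b" "b \<le> N" "\<And>i. i \<in> {a..<b} \<Longrightarrow> h i = M"
    "1 < a \<Longrightarrow> h (a - 1) < M" "b < N \<Longrightarrow> h b < M"
proof -
  define M where "M = Max (h ` {1..<N})"
  have le: "h i \<le> M" if "i \<in> {1..<N}" for i unfolding M_def using that by simp
  have "M \<in> h ` {1..<N}" unfolding M_def using assms by (intro Max_in) auto
  then obtain j where j: "j \<in> {1..<N}" "h j = M" by blast
  define P where "P a \<longleftrightarrow> 1 \<le> a \<and> a \<le> j \<and> (\<forall>i\<in>{a..j}. h i = M)" for a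
  define a where "a = (LEAST a. P a)"
  have "P j" using j by (auto simp: P_def)
  then have a: "P a" unfolding a_def by (rule LeastI)
  have amin: "\<not> P (a - 1)" if "1 < a" using not_less_Least[of "a - 1" P] that unfolding a_def by simp
  define Q where "Q b \<longleftrightarrow> j < b \<and> b \<le> N \<and> (\<forall>i\<in>{j..<b}. h i = M)" for b
  define b where "b = (GREATEST b. Q b)"
  have "Q (j + 1)" using j by (auto simp: Q_def)
  moreover have "\<And>y. Q y \<Longrightarrow> y \<le> N" by (simp add: Q_def)
  ultimately have b: "Q b" unfolding b_def by (rule GreatestI_nat)
  have bmax: "\<not> Q (b + 1)"
  proof
    assume "Q (b + 1)"
    then have "b + 1 \<le> b" unfolding b_def by (rule Greatest_le_nat[of Q _ N]) (simp add: Q_def)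
    then show False by simp
  qed
  show thesis
  proof (rule that)
    show "1 \<le> a" "a < b" "b \<le> N" using a b by (auto simp: P_def Q_def)
    show "h i = M" if "i \<in> {a..<b}" for i
      using a b that by (cases "i \<le> j") (auto simp: P_def Q_def)
    show "h (a - 1) < M" if "1 < a"
    proof -
      have "h (a - 1) \<noteq> M"
      proof
        assume "h (a - 1) = M"
        moreover have "{a - 1..j} = insert (a - 1) {a..j}" using a that by (auto simp: P_def)
        ultimately have "P (a - 1)" using a that by (auto simp: P_def)
        then show False using amin that by simp
      qed
      moreover have "a - 1 \<in> {1..<N}" using a j that by (auto simp: P_def)
      ultimately show ?thesis using le[of "a - 1"] by linarith
    qed
    show "h b < M" if "b < N"
    proof -
      have "h b \<noteq> M"
      proof
        assume "h b = M"
        then have "Q (b + 1)" using b that by (auto simp: Q_def less_Suc_eq)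
        then show False using bmax by simp
      qed
      moreover have "b \<in> {1..<N}" using b that by (auto simp: Q_def)
      ultimately show ?thesis using le[of b] by linarith
    qed
  qed
qed

text \<open>Induction on the number of islands. Lowering a highest plateau to its higher neighbour
  subtracts a positive multiple of its bracket vector and leaves strictly fewer islands, all of them
  islands of \<open>h\<close>. A plateau without neighbours makes the vector a multiple of the
  all-ones vector.\<close>

lemma vector_in_island_cone:
  fixes pos :: "'n::finite \<Rightarrow> nat"
  assumes N: "2 \<le> N" and pos: "bij_betw pos UNIV {1..N-1}"
  shows "(\<chi> k. h (pos k)) \<in> cone_mod_ones (bracket_vector pos ` islands N h)"
proof (induction "card (islands N h)" arbitrary: h rule: less_induct)
  case less
  obtain a b M where ab: "1 \<le> a" "a < b" "b \<le> N" and M: "\<And>i. i \<in> {a..<b} \<Longrightarrow> h i = M"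
    and l: "1 < a \<Longrightarrow> h (a - 1) < M" and r: "b < N \<Longrightarrow> h b < M"
    using highest_plateau[OF N, of h] by blast
  show ?case
  proof (cases "1 < a \<or> b < N")
    case False
    have "h (pos k) = M" for k
      using bij_betwE[OF pos, rule_format, of k] False ab N by (intro M) auto
    then have "(\<chi> k. h (pos k)) = M *\<^sub>R 1" by (simp add: vec_eq_iff)
    then show ?thesis by (simp add: ones_in_cone_mod_ones)
  next
    case True
    \<comment> \<open>\<open>m\<close> is the larger of the heights of those adjacent gaps that
      exist.\<close>
    obtain m where m: "m < M" "1 < a \<Longrightarrow> h (a - 1) \<le> m" "b < N \<Longrightarrow> h b \<le> m"
      "1 < a \<and> h (a - 1) = m \<or> b < N \<and> h b = m"
    proof (cases "1 < a \<and> (b < N \<longrightarrow> h b \<le> h (a - 1))")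
      case True
      then show thesis using that[of "h (a - 1)"] l by auto
    next
      case False
      then show thesis using that[of "h b"] r True by force
    qed
    define h' where "h' = (\<lambda>i. if i \<in> {a..<b} then m else h i)"
    have sub: "islands N h' \<subset> islands N h" and A: "{a..b} \<in> islands N h"
      using islands_flatten[where h = h, OF ab M m] unfolding h'_def by blast+
    have "card (islands N h') < card (islands N h)"
      using sub finite_islands by (rule psubset_card_mono[rotated])
    then have "(\<chi> k. h' (pos k)) \<in> cone_mod_ones (bracket_vector pos ` islands N h')"
      by (rule less)
    then have "(\<chi> k. h' (pos k)) \<in> cone_mod_ones (bracket_vector pos ` islands N h)"
      using cone_mod_ones_mono[OF image_mono] sub by blast
    moreover have "(M - m) *\<^sub>R bracket_vector pos {a..b}
        \<in> cone_mod_ones (bracket_vector pos ` islands N h)"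
      using A m(1)
      by (intro convex_cone_scaleR convex_cone_cone_mod_ones subsetD[OF subset_cone_mod_ones]) auto
    moreover have "(\<chi> k. h (pos k)) = (\<chi> k. h' (pos k)) + (M - m) *\<^sub>R bracket_vector pos {a..b}"
      using M by (auto simp: vec_eq_iff h'_def bracket_vector_def)
    ultimately show ?thesis
      by (simp add: convex_cone_add[OF convex_cone_cone_mod_ones])
  qed
qed

text \<open>By nesting, a bracket of \<open>B\<close> covering a gap next to some \<open>A\<close>
  in \<open>B\<close> contains \<open>A\<close>, so it covers all gaps inside \<open>A\<close>,
  where \<open>A\<close> itself adds one to the count. For the converse, an island is compared with
  a smallest bracket of \<open>B\<close> containing it.\<close>

lemma islands_bracketing_height:
  assumes B: "bracketing N B" and N: "1 \<le> N"
  shows "islands N (\<lambda>i. real (card {A \<in> B. i \<in> A \<and> Suc i \<in> A})) = B" (is "islands N ?h = B")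
proof (intro equalityI subsetI)
  note fin = bracketing_finite[OF B]
  fix A assume A: "A \<in> B"
  then obtain a b where ab: "A = {a..b}" "1 \<le> a" "a \<le> b" "b \<le> N"
    using bracketing_subset[OF B] by (blast elim: bracketsE)
  have lt: "?h i < ?h j" if j: "j \<in> {a..<b}" and i: "i + 1 = a \<or> i = b" for i j
  proof -
    have "{A \<in> B. i \<in> A \<and> Suc i \<in> A} \<subset> {A \<in> B. j \<in> A \<and> Suc j \<in> A}"
    proof
      show "{A \<in> B. i \<in> A \<and> Suc i \<in> A} \<subseteq> {A \<in> B. j \<in> A \<and> Suc j \<in> A}"
      proof safe
        fix D assume D: "D \<in> B" "i \<in> D" "Suc i \<in> D"
        have "D \<inter> A \<noteq> {}" "\<not> D \<subseteq> A" using D(2,3) i ab(2,3) by (auto simp: ab(1))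
        then have "A \<subseteq> D" using bracketing_nested[OF B D(1) A] by blast
        then show "j \<in> D" "Suc j \<in> D" using j ab by auto
      qed
      show "{A \<in> B. i \<in> A \<and> Suc i \<in> A} \<noteq> {A \<in> B. j \<in> A \<and> Suc j \<in> A}"
      proof -
        have "A \<in> {A \<in> B. j \<in> A \<and> Suc j \<in> A}" using A j by (simp add: ab(1))
        moreover have "A \<notin> {A \<in> B. i \<in> A \<and> Suc i \<in> A}" using i ab(2) by (auto simp: ab(1))
        ultimately show ?thesis by blast
      qed
    qed
    then show ?thesis using fin by (auto intro: psubset_card_mono)
  qed
  show "A \<in> islands N ?h"
    unfolding ab(1) Icc_in_islands_iff[OF ab(2-4)]
  proof (intro ballI conjI impI)
    fix j assume "j \<in> {a..<b}"
    then show "?h (a - 1) < ?h j" "?h b < ?h j" using lt[of j "a - 1"] lt[of j b] ab(2) by simp_all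
  qed
next
  note fin = bracketing_finite[OF B]
  fix A assume A: "A \<in> islands N ?h"
  then obtain a b where ab: "A = {a..b}" "1 \<le> a" "a \<le> b" "b \<le> N"
    using islands_subset_brackets by (blast elim: bracketsE)
  note isl = Icc_in_islandsD[OF A[unfolded ab(1)]]
  have "\<exists>D. D \<in> B \<and> A \<subseteq> D" using whole_in_bracketing[OF B] ab by auto
  then obtain D where D: "D \<in> B" "A \<subseteq> D" and Dmin: "\<And>E. E \<in> B \<Longrightarrow> A \<subseteq> E \<Longrightarrow> card D \<le> card E"
    using ex_has_least_nat[of "\<lambda>D. D \<in> B \<and> A \<subseteq> D" _ card] by metis
  obtain c d where cd: "D = {c..d}" "1 \<le> c" "c \<le> d" "d \<le> N"
    using D(1) bracketing_subset[OF B] by (blast elim: bracketsE)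
  have ac: "c \<le> a" "b \<le> d" using D(2) ab cd by auto
  have "A = D"
  proof (rule ccontr)
    assume "A \<noteq> D"
    text \<open>Each gap inside \<open>A\<close> is strictly higher than a gap of \<open>D\<close> next to \<open>A\<close>, so
      it is covered by a bracket that does not contain \<open>A\<close>; a maximal such bracket at \<open>a\<close> cannot end inside \<open>A\<close>.\<close>
    have cover: "\<exists>E\<in>B. j \<in> E \<and> Suc j \<in> E \<and> \<not> A \<subseteq> E" if j: "j \<in> {a..<b}" for j
    proof -
      \<comment> \<open>\<open>D\<close> is larger than \<open>A\<close>, so it reaches beyond
        \<open>A\<close> on some side; \<open>i\<close> is the gap next to \<open>A\<close> on that
        side.\<close>
      obtain i where i: "?h i < ?h j" "i \<in> D" "Suc i \<in> D"
      proof (cases "c < a")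
        case True
        then have "a - 1 \<in> D" "Suc (a - 1) \<in> D" "1 < a" using cd ab ac by auto
        then show thesis using that[of "a - 1"] isl(1)[of j] j by simp
      next
        case False
        then have "b < d" using \<open>A \<noteq> D\<close> unfolding ab(1) cd(1) using ac by auto
        then have "b \<in> D" "Suc b \<in> D" "b < N" using cd ab ac by auto
        then show thesis using that[of b] isl(2)[of j] j by simp
      qed
      have "\<not> {A \<in> B. j \<in> A \<and> Suc j \<in> A} \<subseteq> {A \<in> B. i \<in> A \<and> Suc i \<in> A}"
      proof
        assume "{A \<in> B. j \<in> A \<and> Suc j \<in> A} \<subseteq> {A \<in> B. i \<in> A \<and> Suc i \<in> A}"
        then have "?h j \<le> ?h i" using fin by (simp add: card_mono)
        then show False using i(1) by simp
      qed
      then obtain E where E: "E \<in> B" "j \<in> E" "Suc j \<in> E" "\<not> (i \<in> E \<and> Suc i \<in> E)" by blast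
      have "\<not> A \<subseteq> E"
      proof
        \<comment> \<open>Minimality of \<open>D\<close> together with nesting forces
          \<open>E\<close> to contain \<open>D\<close>, so \<open>E\<close> would cover gap
          \<open>i\<close>.\<close>
        assume "A \<subseteq> E"
        then have "card D \<le> card E" using Dmin E(1) by blast
        moreover have "j \<in> E \<inter> D" using j D(2) E(2) by (auto simp: ab(1))
        then have "E \<subseteq> D \<or> D \<subseteq> E" using bracketing_nested[OF B E(1) D(1)] by blast
        moreover have "finite D" by (simp add: cd(1))
        ultimately have "D \<subseteq> E" using card_seteq by blast
        then show False using E(4) i by blast
      qed
      then show ?thesis using E by blast
    qed
    have "a < b"
    proof (rule ccontr)
      assume "\<not> a < b"
      then have "A = {a}" "A \<in> B"
        using ab B by (auto simp: bracketing_def min_bracketing_def)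
      then have "card D \<le> card A" using Dmin[of A] by simp
      then show False using D(2) \<open>A \<noteq> D\<close> card_seteq[of D A] cd(1) by simp
    qed
    let ?P = "\<lambda>E. E \<in> B \<and> a \<in> E \<and> Suc a \<in> E \<and> \<not> A \<subseteq> E"
    obtain E0 where "?P E0" using cover[of a] \<open>a < b\<close> by auto
    moreover have "\<forall>E. ?P E \<longrightarrow> card E < Suc N"
    proof (intro allI impI)
      fix E assume "?P E"
      then have "E \<subseteq> {1..N}" using bracketing_subset[OF B] brackets_subset by blast
      then have "card E \<le> card {1..N}" by (intro card_mono) simp
      then show "card E < Suc N" by simp
    qed
    ultimately have "\<exists>E. ?P E \<and> (\<forall>E'. ?P E' \<longrightarrow> card E' \<le> card E)"
      by (rule Lattices_Big.ex_has_greatest_nat)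
    then obtain E where E: "?P E" and Emax: "\<And>E'. ?P E' \<Longrightarrow> card E' \<le> card E" by blast
    obtain p q where pq: "E = {p..q}"
      using E bracketing_subset[OF B] by (blast elim: bracketsE)
    \<comment> \<open>\<open>E\<close> starts at or before \<open>a\<close> and misses part of
      \<open>A\<close>, so it ends before \<open>b\<close>. The bracket covering gap
      \<open>q\<close> meets \<open>E\<close> and reaches past it, hence strictly contains
      \<open>E\<close>, against maximality.\<close>
    have q: "q \<in> {a..<b}" using E pq ab by auto
    then obtain E' where E': "E' \<in> B" "q \<in> E'" "Suc q \<in> E'" "\<not> A \<subseteq> E'" using cover by blast
    have "q \<in> E" using E pq by auto
    then have "E \<subseteq> E' \<or> E' \<subseteq> E" using bracketing_nested[OF B] E E'(1,2) by blast
    moreover have "Suc q \<notin> E" using pq by auto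
    ultimately have "E \<subset> E'" using E'(3) by blast
    moreover have "finite E'" using E'(1) bracketing_subset[OF B] by (blast elim: bracketsE)
    ultimately have "card E < card E'" by (metis psubset_card_mono)
    moreover have "?P E'" using E E' \<open>E \<subset> E'\<close> by blast
    ultimately show False using Emax[of E'] by simp
  qed
  then show "A \<in> B" using D by simp
qed

subsection \<open>Loday's associahedron\<close>

lemma inner_bracket_vector:
  "bracket_vector pos A \<bullet> x = (\<Sum>k | pos k \<in> A \<and> pos k + 1 \<in> A. x $ k)"
proof -
  have "bracket_vector pos A \<bullet> x = (\<Sum>k\<in>UNIV. if pos k \<in> A \<and> pos k + 1 \<in> A then x $ k else 0)"
    unfolding inner_vec_def by (intro sum.cong) (auto simp: bracket_vector_def)
  also have "\<dots> = (\<Sum>k\<in>{k\<in>UNIV. pos k \<in> A \<and> pos k + 1 \<in> A}. x $ k)"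
    by (subst sum.inter_filter) simp_all
  finally show ?thesis by simp
qed

lemma inner_bracket_vector_pos:
  fixes pos :: "'n::finite \<Rightarrow> nat"
  assumes pos: "bij_betw pos UNIV {1..N-1}" and ab: "1 \<le> a" "b \<le> N"
  shows "bracket_vector pos {a..b} \<bullet> (\<chi> k. w (pos k)) = sum w {a..<b}"
proof -
  let ?K = "{k. pos k \<in> {a..b} \<and> pos k + 1 \<in> {a..b}}"
  have "inj_on pos ?K" using bij_betw_imp_inj_on[OF pos] by (rule inj_on_subset) simp
  moreover have "pos ` ?K = {a..<b}"
  proof (intro equalityI subsetI)
    fix i assume i: "i \<in> {a..<b}"
    then have "i \<in> pos ` UNIV" using bij_betw_imp_surj_on[OF pos] ab by auto
    then obtain k where "i = pos k" by blast
    then show "i \<in> pos ` ?K" using i by auto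
  qed auto
  ultimately have "bij_betw pos ?K {a..<b}" by (simp add: bij_betw_def)
  then have "(\<Sum>k\<in>?K. w (pos k)) = sum w {a..<b}" by (rule sum.reindex_bij_betw)
  then show ?thesis by (simp add: inner_bracket_vector)
qed

text \<open>Singletons can be included because both sides vanish, and the all-ones vector is the
  vector of the whole bracket. Membership thus becomes a condition on brackets alone.\<close>

lemma mem_loday_associahedron_iff:
  assumes pos: "bij_betw pos UNIV {1..N-1}"
  shows "x \<in> loday_associahedron N pos \<longleftrightarrow>
    bracket_vector pos {1..N} \<bullet> x = real (N choose 2) \<and>
    (\<forall>A\<in>brackets N. real (card A choose 2) \<le> bracket_vector pos A \<bullet> x)"
proof -
  have whole: "bracket_vector pos {1..N} \<bullet> x = (\<Sum>k\<in>UNIV. x $ k)"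
    unfolding bracket_vector_whole[OF pos] by (simp add: inner_vec_def)
  have br: "bracket_vector pos {a..b} \<bullet> x = (\<Sum>k | pos k \<in> {a..b-1}. x $ k)"
    "card {a..b} = b - a + 1" if "a < b" for a b
    using that unfolding inner_bracket_vector by (auto intro!: sum.cong)
  have "(\<forall>A\<in>brackets N. real (card A choose 2) \<le> bracket_vector pos A \<bullet> x) \<longleftrightarrow>
    (\<forall>a b. 1 \<le> a \<and> a < b \<and> b \<le> N \<longrightarrow>
      (\<Sum>k | pos k \<in> {a..b-1}. x $ k) \<ge> real ((b - a + 1) choose 2))" (is "?L \<longleftrightarrow> ?R")
  proof
    assume L: ?L
    show ?R
    proof (intro allI impI)
      fix a b assume "1 \<le> a \<and> a < b \<and> b \<le> N"
      then show "real ((b - a + 1) choose 2) \<le> (\<Sum>k | pos k \<in> {a..b-1}. x $ k)"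
        using L[rule_format, of "{a..b}"] br[of a b] by (simp add: bracketsI)
    qed
  next
    assume R: ?R
    show ?L
    proof
      fix A assume "A \<in> brackets N"
      then obtain a b where ab: "A = {a..b}" "1 \<le> a" "a \<le> b" "b \<le> N" by (rule bracketsE)
      show "real (card A choose 2) \<le> bracket_vector pos A \<bullet> x"
      proof (cases "a = b")
        case True
        then show ?thesis by (simp add: ab(1) bracket_vector_singleton)
      next
        case False
        then show ?thesis using R[rule_format, of a b] br[of a b] ab by simp
      qed
    qed
  qed
  then show ?thesis
    unfolding loday_associahedron_def mem_Collect_eq whole by (rule arg_cong2[OF refl, symmetric])
qed

section \<open>Points of the polytope from masses of leaf pairs\<close>

definition leaf_pairs :: "nat set \<Rightarrow> nat set set" where
  "leaf_pairs A = {p. p \<subseteq> A \<and> card p = 2}"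

text \<open>Keeping all minimisers makes ties count: if a gap next to an interval is as low as the
  lowest gap inside, some pair reaching outside sends mass inside. This matches the strict
  inequalities in \<open>islands\<close>.\<close>

definition lowest_gaps :: "(nat \<Rightarrow> real) \<Rightarrow> nat set \<Rightarrow> nat set" where
  "lowest_gaps h p = {i \<in> {Min p..<Max p}. \<forall>j\<in>{Min p..<Max p}. h i \<le> h j}"

text \<open>When \<open>h\<close> is injective on the gaps, entry \<open>i\<close> is the product of
  the numbers of leaves left and right of gap \<open>i\<close> within the largest interval in which
  this gap is lowest. These are the coordinates of Loday's vertices; ties share the mass
  equally.\<close>

definition loday_mass :: "nat \<Rightarrow> (nat \<Rightarrow> real) \<Rightarrow> nat \<Rightarrow> real" where
  "loday_mass N h i =
     (\<Sum>p\<in>leaf_pairs {1..N}. if i \<in> lowest_gaps h p then 1 / card (lowest_gaps h p) else 0)"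

lemma card_leaf_pairs: "finite A \<Longrightarrow> card (leaf_pairs A) = card A choose 2"
  unfolding leaf_pairs_def by (rule n_subsets)

lemma finite_leaf_pairs: "finite A \<Longrightarrow> finite (leaf_pairs A)"
  unfolding leaf_pairs_def by simp

lemma finite_lowest_gaps: "finite (lowest_gaps h p)"
  unfolding lowest_gaps_def by simp

lemma leaf_pairs_Min_Max:
  assumes "p \<in> leaf_pairs A"
  shows "Min p \<in> p" "Max p \<in> p" "Min p < Max p"
proof -
  obtain u v where "p = {u, v}" "u \<noteq> v"
    using assms by (auto simp: leaf_pairs_def card_2_iff)
  then show "Min p \<in> p" "Max p \<in> p" "Min p < Max p"
    by (auto simp: min_def max_def)
qed

lemma lowest_gaps_nonempty:
  assumes "p \<in> leaf_pairs A" shows "lowest_gaps h p \<noteq> {}"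
proof -
  have "finite (h ` {Min p..<Max p})" "h ` {Min p..<Max p} \<noteq> {}"
    using leaf_pairs_Min_Max(3)[OF assms] by auto
  then have "Min (h ` {Min p..<Max p}) \<in> h ` {Min p..<Max p}" by (rule Min_in)
  then obtain i where "i \<in> {Min p..<Max p}" "h i = Min (h ` {Min p..<Max p})" by force
  then have "i \<in> lowest_gaps h p" by (simp add: lowest_gaps_def)
  then show ?thesis by blast
qed

lemma sum_loday_mass:
  assumes "finite S"
  shows "sum (loday_mass N h) S =
    (\<Sum>p\<in>leaf_pairs {1..N}. card (S \<inter> lowest_gaps h p) / card (lowest_gaps h p))"
proof -
  have "sum (loday_mass N h) S = (\<Sum>p\<in>leaf_pairs {1..N}. \<Sum>i\<in>S.
      if i \<in> lowest_gaps h p then 1 / card (lowest_gaps h p) else 0)"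
    unfolding loday_mass_def by (rule sum.swap)
  also have "\<dots> = (\<Sum>p\<in>leaf_pairs {1..N}. card (S \<inter> lowest_gaps h p) / card (lowest_gaps h p))"
    using assms by (intro sum.cong refl) (simp flip: sum.inter_restrict)
  finally show ?thesis .
qed

text \<open>A pair inside \<open>{a..b}\<close> has all its lowest gaps in \<open>{a..<b}\<close>
  and contributes its full unit. The remaining sum is the surplus from pairs with a leaf
  outside.\<close>

lemma loday_mass_interval:
  assumes ab: "1 \<le> a" "a \<le> b" "b \<le> N"
  shows "sum (loday_mass N h) {a..<b} = real (card {a..b} choose 2) +
    (\<Sum>p\<in>leaf_pairs {1..N} - leaf_pairs {a..b}.
      card ({a..<b} \<inter> lowest_gaps h p) / card (lowest_gaps h p))"
proof -
  let ?f = "\<lambda>p. real (card ({a..<b} \<inter> lowest_gaps h p)) / real (card (lowest_gaps h p))"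
  have "leaf_pairs {a..b} \<subseteq> leaf_pairs {1..N}" using ab by (auto simp: leaf_pairs_def)
  then have "sum ?f (leaf_pairs {1..N}) =
      sum ?f (leaf_pairs {1..N} - leaf_pairs {a..b}) + sum ?f (leaf_pairs {a..b})"
    by (rule sum.subset_diff) (simp add: finite_leaf_pairs)
  moreover have "?f p = 1" if p: "p \<in> leaf_pairs {a..b}" for p
  proof -
    have "Min p \<in> {a..b}" "Max p \<in> {a..b}"
      using leaf_pairs_Min_Max[OF p] p by (auto simp: leaf_pairs_def)
    then have "{a..<b} \<inter> lowest_gaps h p = lowest_gaps h p" by (auto simp: lowest_gaps_def)
    \<comment> \<open>Without a lowest gap the quotient would be \<open>0 / 0 = 0\<close> instead of
      1.\<close>
    moreover have "card (lowest_gaps h p) \<noteq> 0"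
      using lowest_gaps_nonempty[OF p] finite_lowest_gaps by simp
    ultimately show ?thesis by simp
  qed
  then have "sum ?f (leaf_pairs {a..b}) = (\<Sum>p\<in>leaf_pairs {a..b}. 1)"
    by (rule sum.cong[OF refl])
  then have "sum ?f (leaf_pairs {a..b}) = real (card {a..b} choose 2)"
    using card_leaf_pairs[of "{a..b}"] by simp
  ultimately show ?thesis by (simp add: sum_loday_mass)
qed

lemma loday_mass_interval_ge:
  assumes "1 \<le> a" "a \<le> b" "b \<le> N"
  shows "real (card {a..b} choose 2) \<le> sum (loday_mass N h) {a..<b}"
  unfolding loday_mass_interval[OF assms] by (simp add: sum_nonneg)

text \<open>The surplus vanishes iff no pair with a leaf outside has a lowest gap inside. Pairs
  reaching one leaf further than the interval test the strict inequalities. Conversely, a pair with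
  a leaf outside that spans an inner gap also spans an adjacent one, which for an island is strictly
  lower.\<close>

lemma loday_mass_interval_eq_iff:
  assumes ab: "1 \<le> a" "a \<le> b" "b \<le> N"
  shows "sum (loday_mass N h) {a..<b} = real (card {a..b} choose 2) \<longleftrightarrow> {a..b} \<in> islands N h"
proof -
  have "sum (loday_mass N h) {a..<b} = real (card {a..b} choose 2) \<longleftrightarrow>
    (\<forall>p\<in>leaf_pairs {1..N} - leaf_pairs {a..b}. {a..<b} \<inter> lowest_gaps h p = {})" (is "_ \<longleftrightarrow> ?R")
  proof -
    have "card ({a..<b} \<inter> lowest_gaps h p) / card (lowest_gaps h p) = 0 \<longleftrightarrow>
        {a..<b} \<inter> lowest_gaps h p = {}" for p
      using finite_lowest_gaps[of h p] by auto
    then show ?thesis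
      unfolding loday_mass_interval[OF ab] add_cancel_left_right
      by (subst sum_nonneg_eq_0_iff) (auto simp: finite_leaf_pairs)
  qed
  also have "?R \<longleftrightarrow> {a..b} \<in> islands N h"
  proof
    assume R: ?R
    \<comment> \<open>The pair \<open>{u, v}\<close> spans \<open>{a..b}\<close> and more. A lowest
      inner gap is no higher than \<open>j\<close>, hence no higher than the other gaps between
      \<open>u\<close> and \<open>v\<close>, so this pair puts mass inside.\<close>
    have low: False
      if j: "j \<in> {a..<b}" and uv: "1 \<le> u" "u \<le> a" "b \<le> v" "v \<le> N" "(u, v) \<noteq> (a, b)"
        and h: "\<And>i. i \<in> {u..<v} \<Longrightarrow> i \<notin> {a..<b} \<Longrightarrow> h j \<le> h i" for j u v
    proof -
      have p: "{u, v} \<in> leaf_pairs {1..N} - leaf_pairs {a..b}"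
        using uv j by (auto simp: leaf_pairs_def)
      have "Min (h ` {a..<b}) \<in> h ` {a..<b}" using j by (intro Min_in) auto
      then obtain i where i: "i \<in> {a..<b}" "h i = Min (h ` {a..<b})" by force
      then have le: "h i \<le> h k" if "k \<in> {a..<b}" for k using that by simp
      have "h i \<le> h k" if "k \<in> {u..<v}" for k
        using le[of k] le[OF j] h[OF that] by (cases "k \<in> {a..<b}") auto
      moreover have "Min {u, v} = u" "Max {u, v} = v" using uv j by auto
      ultimately have "i \<in> lowest_gaps h {u, v}"
        unfolding lowest_gaps_def using i(1) uv by simp
      then show False using R p i(1) by blast
    qed
    show "{a..b} \<in> islands N h"
      unfolding Icc_in_islands_iff[OF ab]
    proof (intro ballI conjI impI)
      fix j assume j: "j \<in> {a..<b}"
      show "h (a - 1) < h j" if "1 < a"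
      proof (rule ccontr)
        assume "\<not> h (a - 1) < h j"
        moreover have "i = a - 1" if "i \<in> {a - 1..<b}" "i \<notin> {a..<b}" for i using that by auto
        ultimately have "h j \<le> h i" if "i \<in> {a - 1..<b}" "i \<notin> {a..<b}" for i
          using that by (metis linorder_not_less)
        then show False using \<open>1 < a\<close> ab by (intro low[OF j, of "a - 1" b]) auto
      qed
      show "h b < h j" if "b < N"
      proof (rule ccontr)
        assume "\<not> h b < h j"
        moreover have "i = b" if "i \<in> {a..<b + 1}" "i \<notin> {a..<b}" for i using that by auto
        ultimately have "h j \<le> h i" if "i \<in> {a..<b + 1}" "i \<notin> {a..<b}" for i
          using that by (metis linorder_not_less)
        then show False using \<open>b < N\<close> ab by (intro low[OF j, of a "b + 1"]) auto
      qed
    qed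
  next
    assume isl: "{a..b} \<in> islands N h"
    show ?R
    proof (rule ccontr)
      assume "\<not> ?R"
      then obtain p i where p: "p \<in> leaf_pairs {1..N}" "p \<notin> leaf_pairs {a..b}"
        and i: "a \<le> i" "i < b" "i \<in> lowest_gaps h p" by auto
      have i': "Min p \<le> i" "i < Max p" and low: "\<And>j. j \<in> {Min p..<Max p} \<Longrightarrow> h i \<le> h j"
        using i(3) by (auto simp: lowest_gaps_def)
      have "finite p" "p \<subseteq> {1..N}" using p(1) by (auto simp: leaf_pairs_def intro: card_ge_0_finite)
      have "\<not> p \<subseteq> {a..b}" using p by (auto simp: leaf_pairs_def)
      then have "\<not> (a \<le> Min p \<and> Max p \<le> b)"
        using \<open>finite p\<close> by (meson Max_ge Min_le atLeastAtMost_iff order_trans subsetI)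
      moreover have "1 \<le> Min p" "Max p \<le> N"
        using leaf_pairs_Min_Max[OF p(1)] \<open>p \<subseteq> {1..N}\<close> by auto
      ultimately consider "1 < a" "a - 1 \<in> {Min p..<Max p}" | "b < N" "b \<in> {Min p..<Max p}"
        using i i' by fastforce
      then show False
        using low Icc_in_islandsD[OF isl i(1,2)] by cases force+
    qed
  qed
  finally show ?thesis .
qed

definition tight_brackets :: "nat \<Rightarrow> ('n::finite \<Rightarrow> nat) \<Rightarrow> real ^ 'n \<Rightarrow> nat set set" where
  "tight_brackets N pos x = {A \<in> brackets N. bracket_vector pos A \<bullet> x = real (card A choose 2)}"

context
  fixes N :: nat and pos :: "'n::finite \<Rightarrow> nat" and h :: "nat \<Rightarrow> real"
  assumes N: "2 \<le> N" and pos: "bij_betw pos UNIV {1..N-1}"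
begin

lemma tight_brackets_loday_mass:
  "tight_brackets N pos (\<chi> k. loday_mass N h (pos k)) = islands N h"
proof -
  have "A \<in> tight_brackets N pos (\<chi> k. loday_mass N h (pos k)) \<longleftrightarrow> A \<in> islands N h"
    if "A \<in> brackets N" for A
    using that
  proof (rule bracketsE)
    fix a b assume ab: "A = {a..b}" "1 \<le> a" "a \<le> b" "b \<le> N"
    then show ?thesis
      using that loday_mass_interval_eq_iff[OF ab(2-4)] inner_bracket_vector_pos[OF pos, of a b]
      by (simp add: tight_brackets_def)
  qed
  then show ?thesis using islands_subset_brackets unfolding tight_brackets_def by blast
qed

lemma loday_mass_in_loday_associahedron:
  "(\<chi> k. loday_mass N h (pos k)) \<in> loday_associahedron N pos"
proof -
  have "{1..N} \<in> islands N h" using bracketing_islands N by (intro whole_in_bracketing) simp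
  then have "{1..N} \<in> tight_brackets N pos (\<chi> k. loday_mass N h (pos k))"
    by (simp add: tight_brackets_loday_mass)
  moreover have "real (card A choose 2) \<le> bracket_vector pos A \<bullet> (\<chi> k. loday_mass N h (pos k))"
    if "A \<in> brackets N" for A
    using that
  proof (rule bracketsE)
    fix a b assume ab: "A = {a..b}" "1 \<le> a" "a \<le> b" "b \<le> N"
    then show ?thesis
      using loday_mass_interval_ge[OF ab(2-4)] inner_bracket_vector_pos[OF pos, of a b] by simp
  qed
  ultimately show ?thesis
    unfolding mem_loday_associahedron_iff[OF pos] tight_brackets_def by simp
qed

end

subsection \<open>Normal cones\<close>

lemma real_choose_two: "real (n choose 2) = real n * (real n - 1) / 2"
  by (cases n) (simp_all add: choose_two real_of_nat_div algebra_simps)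

text \<open>The vectors of two crossing brackets add up to those of their union and intersection,
  whose lower bounds exceed the sum of the two tight values.\<close>

lemma bracketing_tight_brackets:
  assumes N: "2 \<le> N" and pos: "bij_betw pos UNIV {1..N-1}" and x: "x \<in> loday_associahedron N pos"
  shows "bracketing N (tight_brackets N pos x)"
proof (rule bracketingI)
  note x = x[unfolded mem_loday_associahedron_iff[OF pos]]
  show "{1..N} \<in> tight_brackets N pos x"
    using x N bracketsI[of 1 N N] by (simp add: tight_brackets_def)
  show "{j} \<in> tight_brackets N pos x" if "j \<in> {1..N}" for j
    using that bracketsI[of j j N] by (simp add: tight_brackets_def bracket_vector_singleton)
  fix a b c d
  assume tight: "{a..b} \<in> tight_brackets N pos x" "{c..d} \<in> tight_brackets N pos x"
    and le: "1 \<le> a" "a < c" "c \<le> b" "b < d" "d \<le> N"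
  \<comment> \<open>Sharing a single leaf suffices: every gap of \<open>{a..d}\<close> still lies in
    one of the two brackets, and \<open>{c..b}\<close> contributes 0.\<close>
  have "bracket_vector pos {a..b} + bracket_vector pos {c..d} =
      bracket_vector pos {a..d} + bracket_vector pos {c..b}"
    using le by (auto simp: vec_eq_iff bracket_vector_def)
  then have "bracket_vector pos {a..b} \<bullet> x + bracket_vector pos {c..d} \<bullet> x =
      bracket_vector pos {a..d} \<bullet> x + bracket_vector pos {c..b} \<bullet> x"
    by (metis inner_add_left)
  moreover have "real (card {a..d} choose 2) \<le> bracket_vector pos {a..d} \<bullet> x"
    "real (card {c..b} choose 2) \<le> bracket_vector pos {c..b} \<bullet> x"
    using x le bracketsI[of a d N] bracketsI[of c b N] by auto
  ultimately have *: "real (card {a..d} choose 2) + real (card {c..b} choose 2) \<le>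
      real (card {a..b} choose 2) + real (card {c..d} choose 2)"
    using tight by (simp add: tight_brackets_def)
  \<comment> \<open>\<open>e\<close> and \<open>f\<close> count the leaves to the left and right of
    the overlap, \<open>r\<close> those in it. The excess of \<open>n choose 2\<close> for union and
    intersection over the two brackets is exactly \<open>e * f\<close>.\<close>
  define e f r where "e = real c - real a" "f = real d - real b" "r = real b + 1 - real c"
  have card: "real (card {a..d}) = r + e + f" "real (card {c..b}) = r"
      "real (card {a..b}) = r + e" "real (card {c..d}) = r + f"
    using le by (simp_all add: e_f_r_def of_nat_diff)
  have "e * f \<le> 0"
    using * unfolding real_choose_two card by (simp add: field_simps)
  moreover have "0 < e" "0 < f" using le by (simp_all add: e_f_r_def)
  ultimately show False by (simp add: mult_le_0_iff)
qed (auto simp: tight_brackets_def)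

lemma bracketing_common_tight_brackets:
  assumes N: "2 \<le> N" and pos: "bij_betw pos UNIV {1..N-1}"
    and F: "F \<subseteq> loday_associahedron N pos" "F \<noteq> {}"
  shows "bracketing N (\<Inter>x\<in>F. tight_brackets N pos x)"
proof -
  have br: "bracketing N (tight_brackets N pos x)" if "x \<in> F" for x
    using bracketing_tight_brackets[OF N pos] F(1) that by blast
  obtain x where x: "x \<in> F" using F(2) by blast
  show ?thesis
    unfolding bracketing_def
  proof (intro conjI ballI impI)
    show "(\<Inter>x\<in>F. tight_brackets N pos x) \<subseteq> brackets N"
      using x bracketing_subset[OF br[OF x]] by blast
    show "min_bracketing N \<subseteq> (\<Inter>x\<in>F. tight_brackets N pos x)"
      using br by (intro INT_greatest) (simp add: bracketing_def)
    fix A A' assume "A \<in> (\<Inter>x\<in>F. tight_brackets N pos x)"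
      "A' \<in> (\<Inter>x\<in>F. tight_brackets N pos x)" "A \<inter> A' \<noteq> {}"
    then show "A \<subseteq> A' \<or> A' \<subseteq> A"
      using x by (intro bracketing_nested[OF br[OF x]]) simp_all
  qed
qed

text \<open>Brackets tight on \<open>F\<close> attain their lower bound there, which gives one
  inclusion. The other is complementary slackness: \<open>y\<close> is decomposed over the islands
  of its own height function, all of which are tight at the mass point. A point of \<open>F\<close>
  has no larger value of \<open>y\<close>, so every island with nonzero coefficient is tight there
  too.\<close>

lemma inner_normal_cone_eq_wonderful_cone:
  fixes pos :: "'n::finite \<Rightarrow> nat"
  assumes N: "2 \<le> N" and pos: "bij_betw pos UNIV {1..N-1}"
    and F: "F \<subseteq> loday_associahedron N pos" "F \<noteq> {}"
  shows "inner_normal_cone (loday_associahedron N pos) F =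
    wonderful_cone pos (\<Inter>x\<in>F. tight_brackets N pos x)" (is "?C = wonderful_cone pos ?B")
proof (intro equalityI subsetI)
  let ?P = "loday_associahedron N pos"
  have one: "1 \<bullet> x = real (N choose 2)" if "x \<in> ?P" for x
    using that unfolding mem_loday_associahedron_iff[OF pos] bracket_vector_whole[OF pos] by blast
  have ge: "real (card A choose 2) \<le> bracket_vector pos A \<bullet> x" if "x \<in> ?P" "A \<in> brackets N" for x A
    using that unfolding mem_loday_associahedron_iff[OF pos] by blast
  have B: "?B \<subseteq> brackets N" using F(2) by (auto simp: tight_brackets_def)
  have "wonderful_cone pos ?B \<subseteq> ?C"
    unfolding wonderful_cone_def
  proof (rule cone_mod_ones_minimal)
    show "convex_cone ?C"
      unfolding convex_cone_iff inner_normal_cone_def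
      by (auto simp: inner_add_left add_mono mult_left_mono)
    show "t *\<^sub>R 1 \<in> ?C" for t
      using one F(1) by (auto simp: inner_normal_cone_def)
    show "bracket_vector pos ` ?B \<subseteq> ?C"
    proof (rule image_subsetI)
      fix A assume A: "A \<in> ?B"
      have "bracket_vector pos A \<bullet> x \<le> bracket_vector pos A \<bullet> z" if "x \<in> F" "z \<in> ?P" for x z
        using A that B ge[of z A] by (auto simp: tight_brackets_def)
      then show "bracket_vector pos A \<in> ?C" by (simp add: inner_normal_cone_def)
    qed
  qed
  then show "y \<in> wonderful_cone pos ?B \<Longrightarrow> y \<in> ?C" for y by blast
  fix y assume y: "y \<in> ?C"
  define h where "h i = y $ inv pos i" for i
  have "inj pos" using pos by (rule bij_betw_imp_inj_on)
  then have yh: "y = (\<chi> k. h (pos k))" by (simp add: vec_eq_iff h_def)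
  let ?I = "islands N h" and ?x = "\<chi> k. loday_mass N h (pos k) :: real ^ 'n"
  have "y \<in> cone_mod_ones (bracket_vector pos ` ?I)"
    unfolding yh using N pos by (rule vector_in_island_cone)
  then obtain c t where c: "\<And>A. 0 \<le> c A"
    and yc: "y = (\<Sum>A\<in>?I. c A *\<^sub>R bracket_vector pos A) + t *\<^sub>R 1"
    by (rule cone_mod_ones_image_coeffs[OF finite_islands]) (rule that)
  have tight: "A \<in> ?B" if A: "A \<in> ?I" "c A \<noteq> 0" for A
  proof
    fix z assume "z \<in> F"
    then have z: "z \<in> ?P" using F(1) by blast
    have x: "?x \<in> ?P" by (rule loday_mass_in_loday_associahedron[OF N pos])
    have "y \<bullet> z \<le> y \<bullet> ?x" using y \<open>z \<in> F\<close> x by (simp add: inner_normal_cone_def)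
    \<comment> \<open>The all-ones term has the same value at both points of the polytope and
      cancels.\<close>
    then have "(\<Sum>A\<in>?I. c A * (bracket_vector pos A \<bullet> z)) \<le>
        (\<Sum>A\<in>?I. c A * (bracket_vector pos A \<bullet> ?x))"
      using one[OF z] one[OF x] by (simp add: yc inner_add_left inner_sum_left)
    also have "\<dots> = (\<Sum>A\<in>?I. c A * real (card A choose 2))"
      using tight_brackets_loday_mass[OF N pos, of h]
      by (intro sum.cong) (auto simp: tight_brackets_def)
    finally have "(\<Sum>A\<in>?I. c A * (bracket_vector pos A \<bullet> z - real (card A choose 2))) \<le> 0"
      by (simp add: right_diff_distrib sum_subtractf)
    moreover have nonneg: "0 \<le> c A * (bracket_vector pos A \<bullet> z - real (card A choose 2))"
      if "A \<in> ?I" for A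
      using that ge[OF z] islands_subset_brackets c by (intro mult_nonneg_nonneg) auto
    ultimately have "(\<Sum>A\<in>?I. c A * (bracket_vector pos A \<bullet> z - real (card A choose 2))) = 0"
      by (intro antisym sum_nonneg)
    then have "c A * (bracket_vector pos A \<bullet> z - real (card A choose 2)) = 0"
      using A nonneg finite_islands by (subst (asm) sum_nonneg_eq_0_iff) auto
    then show "A \<in> tight_brackets N pos z"
      using A islands_subset_brackets by (auto simp: tight_brackets_def)
  qed
  have "y = (\<Sum>A\<in>?I. c A *\<^sub>R bracket_vector pos A) + t *\<^sub>R 1" by (rule yc)
  also have "(\<Sum>A\<in>?I. c A *\<^sub>R bracket_vector pos A) \<in> cone_mod_ones (bracket_vector pos ` ?B)"
  proof (rule sum_in_convex_cone[OF convex_cone_cone_mod_ones])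
    fix A assume A: "A \<in> ?I"
    show "c A *\<^sub>R bracket_vector pos A \<in> cone_mod_ones (bracket_vector pos ` ?B)"
    proof (cases "c A = 0")
      case True
      then show ?thesis
        using convex_cone_contains_0[OF convex_cone_cone_mod_ones] by simp
    next
      case False
      then have "bracket_vector pos A \<in> cone_mod_ones (bracket_vector pos ` ?B)"
        using tight[OF A] by (intro subsetD[OF subset_cone_mod_ones] imageI)
      then show ?thesis using c by (intro convex_cone_scaleR convex_cone_cone_mod_ones)
    qed
  qed
  then have "(\<Sum>A\<in>?I. c A *\<^sub>R bracket_vector pos A) + t *\<^sub>R 1 \<in> cone_mod_ones (bracket_vector pos ` ?B)"
    by (intro convex_cone_add[OF convex_cone_cone_mod_ones] ones_in_cone_mod_ones)
  finally show "y \<in> wonderful_cone pos ?B" by (simp add: wonderful_cone_def)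
qed

section \<open>Faces realising bracketings\<close>

lemma convex_loday_associahedron: "convex (loday_associahedron N pos)"
proof -
  have "loday_associahedron N pos = {x. 1 \<bullet> x = real (N choose 2)} \<inter>
    (\<Inter>(a, b)\<in>{(a, b). 1 \<le> a \<and> a < b \<and> b \<le> N}.
      {x. (\<chi> k. if pos k \<in> {a..b-1} then 1 else 0) \<bullet> x \<ge> real ((b - a + 1) choose 2)})"
    unfolding loday_associahedron_def inner_vec_def
    by (auto simp: if_distrib[of "\<lambda>c. c * _"] sum.If_cases cong: if_cong)
  moreover have "convex \<dots>"
    by (intro convex_Int convex_INT) (auto intro: convex_hyperplane convex_halfspace_ge)
  ultimately show ?thesis by simp
qed

text \<open>Minimising the sum of the bracket vectors of \<open>B\<close> exposes the face of points
  at which all of \<open>B\<close> is tight. The mass point for the height counting brackets of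
  \<open>B\<close> around each gap lies on it and has no further tight brackets.\<close>

lemma face_of_bracketing:
  fixes pos :: "'n::finite \<Rightarrow> nat"
  assumes N: "2 \<le> N" and pos: "bij_betw pos UNIV {1..N-1}" and B: "bracketing N B"
  obtains F where "F face_of loday_associahedron N pos" "F \<noteq> {}"
    "(\<Inter>x\<in>F. tight_brackets N pos x) = B"
proof -
  let ?P = "loday_associahedron N pos"
  let ?s = "\<Sum>A\<in>B. bracket_vector pos A" and ?c = "\<Sum>A\<in>B. real (card A choose 2)"
  let ?F = "?P \<inter> {x. ?s \<bullet> x = ?c}"
  note fin = bracketing_finite[OF B]
  have ge: "real (card A choose 2) \<le> bracket_vector pos A \<bullet> x" if "x \<in> ?P" "A \<in> B" for x A
    using that bracketing_subset[OF B] unfolding mem_loday_associahedron_iff[OF pos] by blast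
  have F: "?s \<bullet> x = ?c \<longleftrightarrow> B \<subseteq> tight_brackets N pos x" if x: "x \<in> ?P" for x
  proof -
    have "?s \<bullet> x = ?c \<longleftrightarrow> (\<Sum>A\<in>B. bracket_vector pos A \<bullet> x - real (card A choose 2)) = 0"
      by (simp add: inner_sum_left sum_subtractf)
    also have "\<dots> \<longleftrightarrow> (\<forall>A\<in>B. bracket_vector pos A \<bullet> x - real (card A choose 2) = 0)"
      using ge[OF x] fin by (intro sum_nonneg_eq_0_iff) auto
    also have "\<dots> \<longleftrightarrow> B \<subseteq> tight_brackets N pos x"
      using bracketing_subset[OF B] by (auto simp: tight_brackets_def)
    finally show ?thesis .
  qed
  define h where "h = (\<lambda>i. real (card {A \<in> B. i \<in> A \<and> Suc i \<in> A}))"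
  let ?x = "\<chi> k. loday_mass N h (pos k) :: real ^ 'n"
  have x: "?x \<in> ?P" by (rule loday_mass_in_loday_associahedron[OF N pos])
  have tx: "tight_brackets N pos ?x = B"
    using islands_bracketing_height[OF B] N
    by (simp add: tight_brackets_loday_mass[OF N pos] flip: h_def)
  have "?s \<bullet> x \<ge> ?c" if "x \<in> ?P" for x
    using ge[OF that] by (simp add: inner_sum_left sum_mono)
  then have "?F face_of ?P"
    by (intro face_of_Int_supporting_hyperplane_ge convex_loday_associahedron)
  moreover have xF: "?x \<in> ?F" using x F[OF x] tx by simp
  moreover have "(\<Inter>x\<in>?F. tight_brackets N pos x) = B"
    using xF tx F by blast
  ultimately show thesis using that by blast
qed

theorem proposition4p6:
  fixes N :: nat and pos :: "'n::finite \<Rightarrow> nat"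
  assumes "N \<ge> 2"
    and "bij_betw pos UNIV {1..N-1}"
  shows "velocity_fan N pos = wonderful_associahedral_fan N pos \<and>
    wonderful_associahedral_fan N pos = inner_normal_fan (loday_associahedron N pos)"
proof
  show "velocity_fan N pos = wonderful_associahedral_fan N pos"
    unfolding velocity_fan_def wonderful_associahedral_fan_def categorical_associahedron_def
    using velocity_cone_eq_wonderful_cone[OF assms(2)] by force
  show "wonderful_associahedral_fan N pos = inner_normal_fan (loday_associahedron N pos)"
    (is "_ = inner_normal_fan ?P")
  \<comment> \<open>Bracketings and faces are matched through the brackets tight on the whole
    face.\<close>
  proof (intro equalityI subsetI)
    fix C assume "C \<in> wonderful_associahedral_fan N pos"
    then obtain B where B: "bracketing N B" "C = wonderful_cone pos B"
      unfolding wonderful_associahedral_fan_def by blast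
    obtain F where "F face_of ?P" "F \<noteq> {}" "(\<Inter>x\<in>F. tight_brackets N pos x) = B"
      using face_of_bracketing[OF assms B(1)] .
    moreover from this have "inner_normal_cone ?P F = C"
      using inner_normal_cone_eq_wonderful_cone[OF assms, of F] face_of_imp_subset[of F ?P]
      by (simp add: B(2))
    ultimately show "C \<in> inner_normal_fan ?P"
      unfolding inner_normal_fan_def by blast
  next
    fix C assume "C \<in> inner_normal_fan ?P"
    then obtain F where F: "F face_of ?P" "F \<noteq> {}" "C = inner_normal_cone ?P F"
      unfolding inner_normal_fan_def by blast
    have "F \<subseteq> ?P" using F(1) by (rule face_of_imp_subset)
    then have "C = wonderful_cone pos (\<Inter>x\<in>F. tight_brackets N pos x)"
      "bracketing N (\<Inter>x\<in>F. tight_brackets N pos x)"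
      using F inner_normal_cone_eq_wonderful_cone[OF assms]
        bracketing_common_tight_brackets[OF assms] by auto
    then show "C \<in> wonderful_associahedral_fan N pos"
      unfolding wonderful_associahedral_fan_def by blast
  qed
qed

end
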